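(* Let $(T_n(X))_{n\ge 0}$ be a sequence of $q$-polynomials and, for every integer $n\ge 0$, set $t_n := T_n(0)$. Then $(T_n(X))_{n\ge 0}$ is Carlitz-type if and only if for all integers $n\ge 0$: $$T_n(X)=\sum_{k=0}^{n}\binom{n}{k}\,t_k\,q^{kX}\,[X]^{n-k}.$$
   Context: Let $q$ be a positive real number, $q\neq 1$, and put $[X]:=\frac{q^X-1}{q-1}$. A $q$-polynomial is a polynomial in $[X]$ (equivalently, in $q^X$) with real coefficients. A sequence $(T_n(X))_{n\ge 0}$ of $q$-polynomials is called Carlitz-type if there is a real sequence $(a_k)_{k\ge 0}$ (called its associated sequence) such that for all integers $n\ge 0$ $$T_n(X)=(q-1)^{-n}\sum_{k=0}^{n}(-1)^{n-k}\binom{n}{k}a_k\,q^{kX}.$$ The convention $[X]^0=1$ is used. *)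

theory Defs
  imports Complex_Main "HOL-Computational_Algebra.Polynomial"
begin

(* Expressions in the indeterminate X are functions of a real variable X, with q^X read as
   q powr X.  For 0 < q, q \<noteq> 1 the bracket takes infinitely many values, so a polynomial in
   [X] is determined by the function of X that it defines. *)

definition qbracket :: "real \<Rightarrow> real \<Rightarrow> real" where
  "qbracket q X = (q powr X - 1) / (q - 1)"

definition q_polynomial :: "real \<Rightarrow> (real \<Rightarrow> real) \<Rightarrow> bool" where
  "q_polynomial q f \<longleftrightarrow> (\<exists>p :: real poly. \<forall>X. f X = poly p (qbracket q X))"

definition associated_sequence ::
    "real \<Rightarrow> (nat \<Rightarrow> real \<Rightarrow> real) \<Rightarrow> (nat \<Rightarrow> real) \<Rightarrow> bool" where
  "associated_sequence q T a \<longleftrightarrow>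
     (\<forall>n X. T n X = (q - 1) powi (- int n) *
        (\<Sum>k=0..n. (-1) ^ (n - k) * real (n choose k) * a k * q powr (real k * X)))"

definition Carlitz_type :: "real \<Rightarrow> (nat \<Rightarrow> real \<Rightarrow> real) \<Rightarrow> bool" where
  "Carlitz_type q T \<longleftrightarrow> (\<forall>n. q_polynomial q (T n)) \<and> (\<exists>a. associated_sequence q T a)"

end

(* Write B(a, x) n for the sum over k of (n choose k) a_k x^(n-k), umbrally (a + x)^n.  Then
   B(B(a, x), y) = B(a, x + y) and B(a, 0) = a.  With h = q - 1 and Q = q^X, being Carlitz-type
   means h^n T_n(X) = B(a_k Q^k, -1) n, whose value at X = 0 is h^n t_n = B(a, -1) n.  The sum in
   the theorem, times h^n, is B(h^k t_k Q^k, Q - 1) n.  Since h^k t_k Q^k = B(a_i Q^i, -Q) k,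
   composition turns it into B(a_k Q^k, -1) n.  Conversely a is recovered from t as
   B(h^k t_k, 1). *)

theory Submission
  imports Defs
begin

text \<open>This is \<open>B\<close> of the overview. At \<open>x = 1\<close> and
  \<open>x = - 1\<close> it gives the binomial transform and its inverse.\<close>

definition binomial_shift :: "(nat \<Rightarrow> 'a::comm_semiring_1) \<Rightarrow> 'a \<Rightarrow> nat \<Rightarrow> 'a" where
  "binomial_shift a x n = (\<Sum>k=0..n. of_nat (n choose k) * a k * x ^ (n - k))"

lemma binomial_shift_0 [simp]: "binomial_shift a 0 n = a n"
proof -
  \<comment> \<open>Only \<open>k = n\<close> survives, through \<open>0 ^ 0 = 1\<close>.\<close>
  have "binomial_shift a 0 n = (\<Sum>k=0..n. if k = n then a n else 0)"
    unfolding binomial_shift_def by (intro sum.cong) (auto simp: power_0_left)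
  then show ?thesis by simp
qed

text \<open>Umbrally \<open>(a + x) ^ n\<close> is homogeneous of degree \<open>n\<close>: each term
  splits \<open>c ^ n\<close> as \<open>c ^ k * c ^ (n - k)\<close>.\<close>

lemma binomial_shift_scale:
  "c ^ n * binomial_shift a x n = binomial_shift (\<lambda>k. c ^ k * a k) (c * x) n"
proof -
  have "c ^ n * (of_nat (n choose k) * a k * x ^ (n - k)) =
      of_nat (n choose k) * (c ^ k * a k) * (c * x) ^ (n - k)" if "k \<le> n" for k
  proof -
    have "c ^ n = c ^ k * c ^ (n - k)"
      using that by (simp flip: power_add)
    then show ?thesis by (simp add: power_mult_distrib ac_simps)
  qed
  then show ?thesis
    by (simp add: binomial_shift_def sum_distrib_left)
qed

text \<open>The left side is the coefficient of \<open>a j\<close> in a composition of two shifts.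
  Trinomial revision pulls \<open>n choose j\<close> out of the sum, and what remains is the
  binomial theorem with exponent \<open>n - j\<close>.\<close>

lemma sum_choose_mult_powers:
  fixes x y :: "'a::comm_semiring_1"
  assumes "j \<le> n"
  shows "(\<Sum>k=j..n. of_nat (n choose k) * of_nat (k choose j) * x ^ (k - j) * y ^ (n - k)) =
    of_nat (n choose j) * (x + y) ^ (n - j)"
proof -
  have "(\<Sum>k=j..n. of_nat (n choose k) * of_nat (k choose j) * x ^ (k - j) * y ^ (n - k)) =
      (\<Sum>k=j..n. of_nat (n choose j) *
        (of_nat ((n - j) choose (k - j)) * x ^ (k - j) * y ^ (n - j - (k - j))))"
  proof (rule sum.cong)
    fix k assume "k \<in> {j..n}"
    then have "of_nat (n choose k) * of_nat (k choose j) =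
        (of_nat (n choose j) * of_nat ((n - j) choose (k - j)) :: 'a)"
      by (simp add: choose_mult flip: of_nat_mult)
    with \<open>k \<in> {j..n}\<close>
    show "of_nat (n choose k) * of_nat (k choose j) * x ^ (k - j) * y ^ (n - k) =
        of_nat (n choose j) *
        (of_nat ((n - j) choose (k - j)) * x ^ (k - j) * y ^ (n - j - (k - j)))"
      by (simp add: mult.assoc)
  qed simp
  also have "\<dots> = (\<Sum>i\<le>n - j. of_nat (n choose j) *
      (of_nat ((n - j) choose i) * x ^ i * y ^ (n - j - i)))"
    using assms
    by (intro sum.reindex_bij_witness[where i = "\<lambda>i. i + j" and j = "\<lambda>k. k - j"]) auto
  finally show ?thesis
    by (simp add: binomial_ring sum_distrib_left)
qed

text \<open>Exchanging the sums over \<open>j \<le> k \<le> n\<close> collects the coefficient of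
  each \<open>a j\<close>, which the preceding lemma evaluates.\<close>

lemma binomial_shift_compose:
  "binomial_shift (binomial_shift a x) y n = binomial_shift a (x + y) n"
proof -
  \<comment> \<open>The inner range \<open>0..k\<close> is written as a restriction of
    \<open>0..n\<close>, the form in which \<open>sum.swap_restrict\<close> exchanges a triangular
    sum.\<close>
  have "binomial_shift (binomial_shift a x) y n =
      (\<Sum>k=0..n. \<Sum>j | j \<in> {0..n} \<and> j \<le> k.
        a j * (of_nat (n choose k) * of_nat (k choose j) * x ^ (k - j) * y ^ (n - k)))"
    unfolding binomial_shift_def sum_distrib_left sum_distrib_right
    by (intro sum.cong) (auto simp: ac_simps)
  also have "\<dots> = (\<Sum>j=0..n. \<Sum>k | k \<in> {0..n} \<and> j \<le> k.
        a j * (of_nat (n choose k) * of_nat (k choose j) * x ^ (k - j) * y ^ (n - k)))"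
    by (rule sum.swap_restrict) auto
  also have "\<dots> = (\<Sum>j=0..n. a j * (\<Sum>k=j..n.
        of_nat (n choose k) * of_nat (k choose j) * x ^ (k - j) * y ^ (n - k)))"
    unfolding sum_distrib_left by (intro sum.cong) auto
  also have "\<dots> = binomial_shift a (x + y) n"
    unfolding binomial_shift_def
    by (intro sum.cong) (simp_all add: sum_choose_mult_powers, simp add: ac_simps)
  finally show ?thesis .
qed

lemma associated_sequence_iff:
  assumes "q > 0" "q \<noteq> 1"
  shows "associated_sequence q T a \<longleftrightarrow>
    (\<forall>n X. (q - 1) ^ n * T n X = binomial_shift (\<lambda>k. (q powr X) ^ k * a k) (- 1) n)"
proof -
  have "(\<Sum>k=0..n. (-1) ^ (n - k) * real (n choose k) * a k * q powr (real k * X)) =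
      binomial_shift (\<lambda>k. (q powr X) ^ k * a k) (- 1) n" for n X
    using assms by (simp add: binomial_shift_def powr_powr[symmetric] powr_realpow
        mult.commute[of "real _" X] ac_simps)
  then show ?thesis
    using assms by (simp add: associated_sequence_def power_int_minus field_simps)
qed

text \<open>Scaling by \<open>q - 1\<close> clears the denominator of the bracket, since
  \<open>(q - 1) * qbracket q X = q powr X - 1\<close>.\<close>

lemma qbracket_sum_eq_binomial_shift:
  assumes "q > 0" "q \<noteq> 1"
  shows "(q - 1) ^ n * (\<Sum>k=0..n. real (n choose k) * t k * q powr (real k * X) *
      qbracket q X ^ (n - k)) =
    binomial_shift (\<lambda>k. (q powr X) ^ k * ((q - 1) ^ k * t k)) (q powr X - 1) n"
proof -
  have "(\<Sum>k=0..n. real (n choose k) * t k * q powr (real k * X) * qbracket q X ^ (n - k)) =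
      binomial_shift (\<lambda>k. (q powr X) ^ k * t k) (qbracket q X) n"
    using assms by (simp add: binomial_shift_def powr_powr[symmetric] powr_realpow
        mult.commute[of "real _" X] ac_simps)
  then show ?thesis
    using assms by (simp add: binomial_shift_scale qbracket_def mult.left_commute)
qed

text \<open>Both directions of the theorem rest on this. By homogeneity the factor
  \<open>Q ^ k\<close> turns the shift by \<open>- 1\<close> into one by \<open>- Q\<close>, and
  \<open>- Q + (Q - 1) = - 1\<close>.\<close>

lemma binomial_shift_twist:
  fixes a b :: "nat \<Rightarrow> 'a::comm_ring_1"
  assumes "b = binomial_shift a (- 1)"
  shows "binomial_shift (\<lambda>k. Q ^ k * b k) (Q - 1) n = binomial_shift (\<lambda>k. Q ^ k * a k) (- 1) n"
proof -
  have "(\<lambda>k. Q ^ k * b k) = binomial_shift (\<lambda>k. Q ^ k * a k) (- Q)"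
    using assms by (simp add: fun_eq_iff binomial_shift_scale)
  then show ?thesis
    by (simp add: binomial_shift_compose)
qed

theorem theorem2p2:
  fixes q :: real and T :: "nat \<Rightarrow> real \<Rightarrow> real" and t :: "nat \<Rightarrow> real"
  assumes "q > 0" and "q \<noteq> 1"
    and "\<And>n. q_polynomial q (T n)"
    and "\<And>n. t n = T n 0"
  shows "Carlitz_type q T \<longleftrightarrow>
    (\<forall>n X. T n X =
      (\<Sum>k=0..n. real (n choose k) * t k * q powr (real k * X) * qbracket q X ^ (n - k)))"
proof -
  define b where "b = (\<lambda>k. (q - 1) ^ k * t k)"
  \<comment> \<open>Both sides are multiplied by \<open>(q - 1) ^ n\<close>, which is
    nonzero.\<close>
  have formula_iff: "T n X =
      (\<Sum>k=0..n. real (n choose k) * t k * q powr (real k * X) * qbracket q X ^ (n - k)) \<longleftrightarrow>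
    (q - 1) ^ n * T n X = binomial_shift (\<lambda>k. (q powr X) ^ k * b k) (q powr X - 1) n" for n X
    unfolding b_def qbracket_sum_eq_binomial_shift[OF assms(1,2), symmetric]
    using \<open>q \<noteq> 1\<close> by simp
  show ?thesis
    unfolding formula_iff
  proof
    assume "Carlitz_type q T"
    then obtain a where
      a: "(q - 1) ^ n * T n X = binomial_shift (\<lambda>k. (q powr X) ^ k * a k) (- 1) n" for n X
      using associated_sequence_iff[OF assms(1,2)] unfolding Carlitz_type_def by blast
    \<comment> \<open>At \<open>X = 0\<close> the factor \<open>q powr X\<close> is 1 and
      \<open>T n 0\<close> is \<open>t n\<close>.\<close>
    have "b = binomial_shift a (- 1)"
      using a[where X = 0] assms by (simp add: b_def fun_eq_iff)
    from binomial_shift_twist[OF this] a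
    show "\<forall>n X. (q - 1) ^ n * T n X =
        binomial_shift (\<lambda>k. (q powr X) ^ k * b k) (q powr X - 1) n"
      by simp
  next
    assume formula: "\<forall>n X. (q - 1) ^ n * T n X =
        binomial_shift (\<lambda>k. (q powr X) ^ k * b k) (q powr X - 1) n"
    \<comment> \<open>The witness for the associated sequence is \<open>binomial_shift b 1\<close>:
      the shifts by 1 and \<open>- 1\<close> compose to the shift by 0.\<close>
    have "b = binomial_shift (binomial_shift b 1) (- 1)"
      by (simp add: fun_eq_iff binomial_shift_compose)
    from binomial_shift_twist[OF this] formula
    have "associated_sequence q T (binomial_shift b 1)"
      by (simp add: associated_sequence_iff[OF assms(1,2)])
    with assms(3) show "Carlitz_type q T"
      unfolding Carlitz_type_def by blast
  qed
qed

end
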